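(* Let $(X,\mathcal{A},\mu)$ be a probability space, and let $T_n\colon X\to X$, $n\ge1$, be measurable, measure-preserving transformations. If $\{T_n\}_{n\in\mathbb{N}}$ has an ergodic subsequence, then: (i) $\{T_n\}_{n\in\mathbb{N}}$ is recurrent; (ii) if, furthermore, $X$ is a second countable topological space whose open sets belong to $\mathcal{A}$, and $\operatorname{supp}(\mu)=X$, then for $\mu$-almost every $x\in X$ the orbit $\{T_n(x):n\ge1\}$ is dense in $X$.
   Context: A sequence $\{S_n\}_{n\in\mathbb{N}}$ of measurable measure-preserving maps of $(X,\mathcal{A},\mu)$ is called ergodic if $\lim_{N\to\infty}\left\|\frac1N\sum_{n=1}^N\varphi\circ S_n-\int_X\varphi\,d\mu\right\|_{2}=0$ for every complex-valued $\varphi\in L^2(\mu)$. The sequence $\{T_n\}$ is recurrent if for every measurable set $A\subset X$, for $\mu$-almost every $x\in A$ one has $T_n(x)\in A$ for infinitely many $n\ge1$. The condition $\operatorname{supp}(\mu)=X$ means that every nonempty open subset of $X$ has positive measure. *)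

theory Defs
  imports "HOL-Probability.Probability"
begin

text \<open>
  Sequences of maps are indexed by the positive integers: every notion below ignores the value
  of the sequence at index 0.
\<close>

definition measure_preserving_map :: "'a measure \<Rightarrow> ('a \<Rightarrow> 'a) \<Rightarrow> bool" where
  "measure_preserving_map M S \<longleftrightarrow>
     S \<in> measurable M M \<and> (\<forall>A\<in>sets M. emeasure M (S -` A \<inter> space M) = emeasure M A)"

definition L2_function :: "'a measure \<Rightarrow> ('a \<Rightarrow> complex) \<Rightarrow> bool" where
  "L2_function M \<phi> \<longleftrightarrow> \<phi> \<in> borel_measurable M \<and> integrable M (\<lambda>x. (norm (\<phi> x))\<^sup>2)"

text \<open>Only meaningful for functions satisfying \<^const>\<open>L2_function\<close>, since the integral of a
  non-integrable function is 0.\<close>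

definition L2_norm :: "'a measure \<Rightarrow> ('a \<Rightarrow> complex) \<Rightarrow> real" where
  "L2_norm M \<phi> = sqrt (\<integral>x. (norm (\<phi> x))\<^sup>2 \<partial>M)"

definition ergodic_sequence :: "'a measure \<Rightarrow> (nat \<Rightarrow> 'a \<Rightarrow> 'a) \<Rightarrow> bool" where
  "ergodic_sequence M S \<longleftrightarrow>
     (\<forall>n\<ge>1. measure_preserving_map M (S n)) \<and>
     (\<forall>\<phi>. L2_function M \<phi> \<longrightarrow>
        (\<lambda>N. L2_norm M (\<lambda>x. (1 / of_nat N) * (\<Sum>n=1..N. \<phi> (S n x)) - (\<integral>y. \<phi> y \<partial>M)))
          \<longlonglongrightarrow> 0)"

text \<open>A strictly increasing \<open>r\<close> satisfies \<open>r n \<ge> n\<close>, so \<open>T (r n)\<close> with \<open>n \<ge> 1\<close> never uses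
  \<open>T 0\<close>; the value \<open>r 0\<close> is irrelevant.\<close>

definition has_ergodic_subsequence :: "'a measure \<Rightarrow> (nat \<Rightarrow> 'a \<Rightarrow> 'a) \<Rightarrow> bool" where
  "has_ergodic_subsequence M T \<longleftrightarrow>
     (\<exists>r :: nat \<Rightarrow> nat. strict_mono r \<and> ergodic_sequence M (\<lambda>n. T (r n)))"

definition recurrent_sequence :: "'a measure \<Rightarrow> (nat \<Rightarrow> 'a \<Rightarrow> 'a) \<Rightarrow> bool" where
  "recurrent_sequence M T \<longleftrightarrow>
     (\<forall>A\<in>sets M. AE x in M. x \<in> A \<longrightarrow> infinite {n. n \<ge> 1 \<and> T n x \<in> A})"

definition full_support :: "'a topology \<Rightarrow> 'a measure \<Rightarrow> bool" where
  "full_support X M \<longleftrightarrow> (\<forall>U. openin X U \<and> U \<noteq> {} \<longrightarrow> emeasure M U > 0)"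

end

theory Submission
  imports Defs
begin

text \<open>
  Let \<open>A\<close> have measure \<open>a > 0\<close>, and let \<open>B\<close> be the set of points that visit \<open>A\<close> only finitely
  often along the ergodic subsequence. On \<open>B\<close> the averages of the indicator of \<open>A\<close> tend to 0
  pointwise, so by dominated convergence their squared \<open>L\<^sup>2\<close> distance to \<open>a\<close>, integrated over \<open>B\<close>,
  tends to \<open>a\<^sup>2 \<mu>(B)\<close>. Ergodicity forces this limit to be 0, hence \<open>\<mu>(B) = 0\<close>: almost every
  point of the whole space visits \<open>A\<close> infinitely often. Recurrence is immediate, and density
  follows by applying this to the members of a countable base.
\<close>

text \<open>Once \<open>N \<ge> k\<close> the sum no longer changes, so the average is a fixed
  number divided by \<open>N\<close>.\<close>

lemma averages_tendsto_0_if_eventually_0: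
  fixes f :: "nat \<Rightarrow> 'b::real_normed_field"
  assumes "\<And>n. n \<ge> k \<Longrightarrow> f n = 0"
  shows "(\<lambda>N. (1 / of_nat N) * (\<Sum>n=1..N. f n)) \<longlonglongrightarrow> 0"
proof -
  have eq: "(\<Sum>n=1..N. f n) = (\<Sum>n=1..k. f n)" if "N \<ge> k" for N
    using that assms by (intro sum.mono_neutral_right) auto
  have "\<forall>\<^sub>F N in sequentially.
      (1 / of_nat N) * (\<Sum>n=1..k. f n) = (1 / of_nat N) * (\<Sum>n=1..N. f n)"
    using eventually_ge_at_top[of k] by eventually_elim (metis eq)
  moreover have "(\<lambda>N. (1 / of_nat N) * (\<Sum>n=1..k. f n)) \<longlonglongrightarrow> 0"
    by (intro tendsto_mult_left_zero lim_1_over_n)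
  ultimately show ?thesis
    by (rule Lim_transform_eventually[rotated])
qed

lemma norm_average_le_1:
  fixes f :: "nat \<Rightarrow> 'b::real_normed_field"
  assumes "\<And>n. norm (f n) \<le> 1"
  shows "norm ((1 / of_nat N) * (\<Sum>n=1..N. f n)) \<le> 1"
proof -
  have "norm (\<Sum>n=1..N. f n) \<le> real N"
    using sum_norm_bound[of "{1..N}" f 1] assms by simp
  then show ?thesis
    \<comment> \<open>Division by zero yields 0, so the average at \<open>N = 0\<close> is
      0.\<close>
    by (cases "N = 0") (auto simp: norm_mult norm_divide field_simps)
qed

lemma ergodic_sequence_visits_infinitely_often:
  assumes "prob_space M" and erg: "ergodic_sequence M S"
    and A: "A \<in> sets M" and pos: "emeasure M A > 0"
  shows "AE x in M. infinite {n. n \<ge> 1 \<and> S n x \<in> A}"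
proof -
  interpret prob_space M by fact
  \<comment> \<open>Starting at \<open>Suc k\<close> keeps out index 0: nothing is known about
    \<open>S 0\<close>, and \<open>B\<close> has to be measurable.\<close>
  define B where "B = {x \<in> space M. \<exists>k. \<forall>n\<in>{Suc k..}. S n x \<notin> A}"
  define a where "a = measure M A"
  define \<phi> :: "'a \<Rightarrow> complex" where "\<phi> = indicat_real A"
  define h where "h N x = (norm ((1 / of_nat N) * (\<Sum>n=1..N. \<phi> (S n x)) - of_real a))\<^sup>2" for N x
  have meas: "S n \<in> measurable M M" if "n \<ge> 1" for n
    using erg that by (simp add: ergodic_sequence_def measure_preserving_map_def)
  have [measurable]: "\<phi> \<in> borel_measurable M"
    unfolding \<phi>_def using A by measurable
  have [measurable]: "h N \<in> borel_measurable M" for N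
  proof -
    have [measurable]: "(\<lambda>x. \<Sum>n=1..N. \<phi> (S n x)) \<in> borel_measurable M"
      by (intro borel_measurable_sum measurable_compose[OF meas]) auto
    show ?thesis
      unfolding h_def by measurable
  qed
  have "{x \<in> space M. S n x \<notin> A} \<in> sets M" if "n \<ge> 1" for n
  proof -
    have "{x \<in> space M. S n x \<notin> A} = space M - (S n -` A \<inter> space M)"
      by auto
    then show ?thesis
      using measurable_sets[OF meas[OF that] A] by auto
  qed
  then have "{x \<in> space M. \<forall>n\<in>{Suc k..}. S n x \<notin> A} \<in> sets M" for k
    by (intro sets.sets_Collect_countable_All') auto
  then have B: "B \<in> sets M"
    unfolding B_def by (rule sets.sets_Collect_countable_Ex)
  have \<phi>_le: "norm (\<phi> x) \<le> 1" for x
    by (simp add: \<phi>_def indicator_def)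
  have int_\<phi>: "(\<integral>y. \<phi> y \<partial>M) = of_real a"
    unfolding \<phi>_def a_def using A by simp
  have "L2_function M \<phi>"
    unfolding L2_function_def
    by (intro conjI integrable_const_bound[of _ 1] AE_I2) (simp_all add: \<phi>_le power_le_one)
  then have "(\<lambda>N. L2_norm M (\<lambda>x. (1 / of_nat N) * (\<Sum>n=1..N. \<phi> (S n x)) - of_real a)) \<longlonglongrightarrow> 0"
    using erg int_\<phi> unfolding ergodic_sequence_def by auto
  then have "(\<lambda>N. sqrt (\<integral>x. h N x \<partial>M)) \<longlonglongrightarrow> 0"
    by (simp add: L2_norm_def h_def)
  \<comment> \<open>Squaring removes the root, because the integral of \<open>h N\<close> is
    nonnegative.\<close>
  from tendsto_power[OF this, of 2] have lim0: "(\<lambda>N. \<integral>x. h N x \<partial>M) \<longlonglongrightarrow> 0"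
    by (simp add: h_def)
  have h_nonneg: "0 \<le> h N x" for N x
    by (simp add: h_def)
  have h_le: "h N x \<le> 4" for N x
  proof -
    \<comment> \<open>Both the average and the probability \<open>a\<close> have norm at most 1;
      this is the source of the bound 4.\<close>
    have "norm ((1 / of_nat N) * (\<Sum>n=1..N. \<phi> (S n x)) - of_real a) \<le> 1 + 1"
      by (rule order_trans[OF norm_triangle_ineq4])
        (intro add_mono norm_average_le_1 \<phi>_le, simp add: a_def)
    from power_mono[OF this, of 2] show ?thesis
      by (simp add: h_def)
  qed
  have int_h: "integrable M (h N)" for N
    by (rule integrable_const_bound[of _ 4]) (auto simp: h_nonneg h_le)
  have lim_h: "(\<lambda>N. h N x) \<longlonglongrightarrow> a\<^sup>2" if "x \<in> B" for x
  proof -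
    obtain k where "\<And>n. n \<ge> Suc k \<Longrightarrow> S n x \<notin> A"
      using \<open>x \<in> B\<close> by (auto simp: B_def)
    then have "(\<lambda>N. (1 / of_nat N) * (\<Sum>n=1..N. \<phi> (S n x))) \<longlonglongrightarrow> 0"
      by (intro averages_tendsto_0_if_eventually_0[of "Suc k"]) (auto simp: \<phi>_def)
    then have "(\<lambda>N. h N x) \<longlonglongrightarrow> (norm (0 - complex_of_real a))\<^sup>2"
      unfolding h_def by (intro tendsto_intros)
    then show ?thesis by simp
  qed
  \<comment> \<open>The constant bound 4 is integrable since \<open>M\<close> is finite. Off
    \<open>B\<close> both integrands vanish, so the pointwise limit of \<open>h\<close> is needed
    only on \<open>B\<close>.\<close>
  have "(\<lambda>N. \<integral>x. indicat_real B x * h N x \<partial>M) \<longlonglongrightarrow> (\<integral>x. indicat_real B x * a\<^sup>2 \<partial>M)"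
    using B lim_h h_nonneg h_le
    by (intro integral_dominated_convergence[where w = "\<lambda>_. 4"])
      (auto simp: indicator_def)
  moreover have "(\<lambda>N. \<integral>x. indicat_real B x * h N x \<partial>M) \<longlonglongrightarrow> 0"
  \<comment> \<open>As \<open>h\<close> is nonnegative, its integral over \<open>B\<close> lies
    between 0 and its integral over the whole space.\<close>
  proof (rule tendsto_sandwich[OF _ _ tendsto_const lim0])
    have "(\<integral>x. indicat_real B x * h N x \<partial>M) \<le> (\<integral>x. h N x \<partial>M)" for N
      using B int_h h_nonneg
      by (intro integral_mono integrable_mult_indicator[of B M "h N", simplified])
        (auto simp: indicator_def)
    then show "\<forall>\<^sub>F N in sequentially. (\<integral>x. indicat_real B x * h N x \<partial>M) \<le> (\<integral>x. h N x \<partial>M)"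
      by simp
    show "\<forall>\<^sub>F N in sequentially. 0 \<le> (\<integral>x. indicat_real B x * h N x \<partial>M)"
      by (simp add: h_nonneg)
  qed
  ultimately have "(\<integral>x. indicat_real B x * a\<^sup>2 \<partial>M) = 0"
    by (rule LIMSEQ_unique)
  moreover have "a > 0"
    using pos by (simp add: a_def emeasure_eq_measure)
  ultimately have "measure M B = 0"
    using B by simp
  then have "AE x in M. x \<notin> B"
    using B by (intro AE_not_in) (auto simp: emeasure_eq_measure null_sets_def)
  then show ?thesis
  proof (rule AE_mp, intro AE_I2 impI)
    fix x assume "x \<in> space M" "x \<notin> B"
    then have "\<exists>n\<ge>Suc k. S n x \<in> A" for k
      by (auto simp: B_def)
    then have "\<exists>n\<ge>k. n \<ge> 1 \<and> S n x \<in> A" for k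
      by (metis Suc_leD Suc_le_mono One_nat_def le0 le_trans)
    then show "infinite {n. n \<ge> 1 \<and> S n x \<in> A}"
      by (simp add: infinite_nat_iff_unbounded_le)
  qed
qed

text \<open>The strictly increasing \<open>r\<close> is injective and satisfies
  \<open>r n \<ge> n\<close>, so it carries infinitely many visit times of the subsequence to
  infinitely many positive visit times of \<open>T\<close>.\<close>

lemma ergodic_subsequence_visits_infinitely_often:
  assumes "prob_space M" and "has_ergodic_subsequence M T"
    and "A \<in> sets M" and "emeasure M A > 0"
  shows "AE x in M. infinite {n. n \<ge> 1 \<and> T n x \<in> A}"
proof -
  obtain r :: "nat \<Rightarrow> nat" where r: "strict_mono r" "ergodic_sequence M (\<lambda>n. T (r n))"
    using assms(2) by (auto simp: has_ergodic_subsequence_def)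
  have "infinite {n. n \<ge> 1 \<and> T n x \<in> A}" if "infinite {n. n \<ge> 1 \<and> T (r n) x \<in> A}" for x
  proof -
    have "r ` {n. n \<ge> 1 \<and> T (r n) x \<in> A} \<subseteq> {n. n \<ge> 1 \<and> T n x \<in> A}"
      using strict_mono_imp_increasing[OF r(1)] order_trans by auto
    moreover have "infinite (r ` {n. n \<ge> 1 \<and> T (r n) x \<in> A})"
      using that r(1) by (metis finite_imageD strict_mono_imp_inj_on)
    ultimately show ?thesis
      using finite_subset by blast
  qed
  with ergodic_sequence_visits_infinitely_often[OF assms(1) r(2) assms(3,4)] show ?thesis
    by auto
qed

theorem theorem1p6:
  fixes M :: "'a measure" and T :: "nat \<Rightarrow> 'a \<Rightarrow> 'a"
  assumes "prob_space M"
    and "\<And>n. n \<ge> 1 \<Longrightarrow> measure_preserving_map M (T n)"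
    and "has_ergodic_subsequence M T"
  shows "recurrent_sequence M T \<and>
    (\<forall>X :: 'a topology.
       topspace X = space M \<and> second_countable X \<and> (\<forall>U. openin X U \<longrightarrow> U \<in> sets M) \<and>
       full_support X M \<longrightarrow>
       (AE x in M. X closure_of {T n x |n. n \<ge> 1} = topspace X))"
proof (intro conjI allI impI; (elim conjE)?)
  note visits = ergodic_subsequence_visits_infinitely_often[OF assms(1,3)]
  show "recurrent_sequence M T"
    unfolding recurrent_sequence_def
  proof
    fix A assume A: "A \<in> sets M"
    show "AE x in M. x \<in> A \<longrightarrow> infinite {n. n \<ge> 1 \<and> T n x \<in> A}"
    \<comment> \<open>\<open>visits\<close> applies only to sets of positive measure; for a null set
      the implication holds vacuously almost everywhere.\<close>
    proof (cases "emeasure M A = 0")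
      case True
      then have "AE x in M. x \<notin> A"
        using A by (intro AE_not_in) auto
      then show ?thesis by auto
    next
      case False
      then show ?thesis
        using visits[OF A] by (auto simp: zero_less_iff_neq_zero)
    qed
  qed
  fix X :: "'a topology"
  assume "second_countable X" and open_sets: "\<forall>U. openin X U \<longrightarrow> U \<in> sets M"
    and supp: "full_support X M"
  then obtain \<B> where \<B>: "countable \<B>" "\<And>V. V \<in> \<B> \<Longrightarrow> openin X V"
    "\<And>U x. openin X U \<Longrightarrow> x \<in> U \<Longrightarrow> \<exists>V\<in>\<B>. x \<in> V \<and> V \<subseteq> U"
    unfolding second_countable_def by metis
  \<comment> \<open>Countability of the base yields one exceptional null set for all its members.
    The empty set is removed because full support gives positive measure to nonempty open sets
    only.\<close>
  have "AE x in M. \<forall>V\<in>\<B> - {{}}. infinite {n. n \<ge> 1 \<and> T n x \<in> V}"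
    using \<B>(1,2) open_sets supp
    by (intro AE_ball_countable' visits) (auto simp: full_support_def)
  then show "AE x in M. X closure_of {T n x |n. n \<ge> 1} = topspace X"
  proof (rule AE_mp, intro AE_I2 impI)
    fix x assume inf: "\<forall>V\<in>\<B> - {{}}. infinite {n. n \<ge> 1 \<and> T n x \<in> V}"
    have "\<exists>n\<ge>1. T n x \<in> U" if "openin X U" "y \<in> U" for U y
    proof -
      \<comment> \<open>The base member chosen around \<open>y\<close> contains \<open>y\<close> and
        is therefore nonempty.\<close>
      obtain V where V: "V \<in> \<B> - {{}}" "V \<subseteq> U"
        using \<B>(3) \<open>openin X U\<close> \<open>y \<in> U\<close> by blast
      then have "{n. n \<ge> 1 \<and> T n x \<in> V} \<noteq> {}"
        using inf by (metis finite.emptyI)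
      then show ?thesis
        using V by blast
    qed
    then show "X closure_of {T n x |n. n \<ge> 1} = topspace X"
      unfolding closure_of_def by blast
  qed
qed

end
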